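(* Let $f:\{0,1\}^n\to\{0,1\}$ be the decision function of a binary classifier over features $X_1,\dots,X_n$, let $OBDD_f$ be an ordered binary decision diagram representing $f$, and let $\Sigma_f$ be the CNF formula obtained from $OBDD_f$, i.e. $\Sigma_f=\bigwedge_{e\in f^0}\neg e$, where $f^0$ is the off-set of $OBDD_f$ (the set of partial assignments given by the paths of $OBDD_f$ from the root to the $0$-sink). Then an interpretation $\mu$ of the Boolean variables $X_1,\dots,X_n$ is a model of $\Sigma_f$ if and only if $f(\mu)=1$.
   Context: A binary classifier has a finite set of binary features $X=\{X_1,\dots,X_n\}$ and a binary class variable $Y$; its decision function is a function $f:\{0,1\}^n\to\{0,1\}$ mapping each instantiation $x$ of $X$ to a class $f(x)$. An ordered binary decision diagram (OBDD) over the ordered variables $X_1,\dots,X_n$ is a rooted directed acyclic graph whose sink (terminal) nodes are labeled by $0$ or $1$ and in which every non-sink node is labeled by a variable $X_i$ and has exactly two outgoing edges, one for each value $0,1$ of $X_i$; if there is an edge from a node labeled $X_i$ to a node labeled $X_j$ then $i<j$ (so variables may be skipped along a path). It represents $f$ if, for every $x\in\{0,1\}^n$, following from the root, at each node labeled $X_i$, the edge for the value $x_i$ leads to the sink labeled $f(x)$. Sinks labeled $0$ are referred to as the $0$-sink. Off-set: each path from the root to the $0$-sink assigns a value to each variable labeling a node on the path, according to the edge taken. This partial assignment $e$ is identified with the conjunction of the corresponding literals ($X_i$ if the value is $1$, $\neg X_i$ if the value is $0$). The off-set $f^0$ is the set of all such $e$. The negation $\neg e$ is a clause (the disjunction of the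 complementary literals; the empty clause, which is false, if $e$ is empty), so $\Sigma_f=\bigwedge_{e\in f^0}\neg e$ is a CNF formula over $X_1,\dots,X_n$ (the empty conjunction being true). An interpretation $\mu$ assigns a value in $\{0,1\}$ to each Boolean variable and is identified with an element of $\{0,1\}^n$; it is a model of a CNF if it satisfies all its clauses. *)

theory Defs
  imports "Graph_Theory.Arc_Walk" "HOL-Library.FuncSet"
begin

text \<open>
  The values 0 and 1 are \<^const>\<open>False\<close> and \<^const>\<open>True\<close>; the variable $X_i$ is its index $i$.
  Elements of $\{0,1\}^n$ are extensional functions on $\{1,\dots,n\}$, so that there are
  exactly $2^n$ of them.
\<close>

definition interps :: "nat \<Rightarrow> (nat \<Rightarrow> bool) set" where
  "interps n = {1..n} \<rightarrow>\<^sub>E UNIV"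


section \<open>Ordered binary decision diagrams\<close>

datatype node_label = Sink (sink_value: bool) | Var (var: nat)

text \<open>
  The underlying graph is a multigraph, since the two edges leaving a node may lead to the
  same node. \<open>edge_value\<close> is the value of the variable at the tail to which an edge belongs.
\<close>

record ('v, 'e) decision_diagram =
  dgraph :: "('v, 'e) pre_digraph"
  root :: 'v
  label :: "'v \<Rightarrow> node_label"
  edge_value :: "'e \<Rightarrow> bool"

text \<open>
  There may be several sinks with the same label: diagrams need not be reduced.
\<close>

definition obdd :: "nat \<Rightarrow> ('v, 'e) decision_diagram \<Rightarrow> bool" where
  "obdd n D \<longleftrightarrow>
     fin_digraph (dgraph D) \<and>
     (\<nexists>p. pre_digraph.cycle (dgraph D) p) \<and>
     root D \<in> verts (dgraph D) \<and>
     (\<forall>v \<in> verts (dgraph D). root D \<rightarrow>\<^sup>*\<^bsub>dgraph D\<^esub> v) \<and>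
     (\<forall>v \<in> verts (dgraph D).
        case label D v of
          Sink b \<Rightarrow> out_arcs (dgraph D) v = {}
        | Var i \<Rightarrow> i \<in> {1..n} \<and> bij_betw (edge_value D) (out_arcs (dgraph D) v) UNIV) \<and>
     (\<forall>e \<in> arcs (dgraph D). \<forall>i j.
        label D (tail (dgraph D) e) = Var i \<longrightarrow> label D (head (dgraph D) e) = Var j \<longrightarrow> i < j)"

text \<open>
  \<open>leads_to D x v b\<close>: following, from \<open>v\<close> on, the edges selected by \<open>x\<close>
  ends in a sink labeled \<open>b\<close>.
\<close>

inductive leads_to ::
  "('v, 'e) decision_diagram \<Rightarrow> (nat \<Rightarrow> bool) \<Rightarrow> 'v \<Rightarrow> bool \<Rightarrow> bool"
  for D :: "('v, 'e) decision_diagram" and x :: "nat \<Rightarrow> bool" where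
  sink: "v \<in> verts (dgraph D) \<Longrightarrow> label D v = Sink b \<Longrightarrow> leads_to D x v b"
| step: "e \<in> out_arcs (dgraph D) v \<Longrightarrow> label D v = Var i \<Longrightarrow> edge_value D e = x i \<Longrightarrow>
         leads_to D x (head (dgraph D) e) b \<Longrightarrow> leads_to D x v b"

definition represents ::
  "nat \<Rightarrow> ('v, 'e) decision_diagram \<Rightarrow> ((nat \<Rightarrow> bool) \<Rightarrow> bool) \<Rightarrow> bool" where
  "represents n D f \<longleftrightarrow> (\<forall>x \<in> interps n. leads_to D x (root D) (f x))"


section \<open>Off-set\<close>

text \<open>
  In an ordered diagram no variable occurs twice on a path, so the precedence of
  \<^const>\<open>map_of\<close> among repeated keys plays no role.
\<close>

definition path_assignment :: "('v, 'e) decision_diagram \<Rightarrow> 'e list \<Rightarrow> nat \<rightharpoonup> bool" where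
  "path_assignment D p =
     map_of (map (\<lambda>e. (var (label D (tail (dgraph D) e)), edge_value D e)) p)"

definition off_set :: "('v, 'e) decision_diagram \<Rightarrow> (nat \<rightharpoonup> bool) set" where
  "off_set D = {path_assignment D p | p t.
     pre_digraph.apath (dgraph D) (root D) p t \<and> label D t = Sink False}"


section \<open>CNF formulas\<close>

datatype literal = Pos nat | Neg nat

text \<open>Clauses and conjunctions of literals are sets of literals, CNFs are sets of clauses.\<close>

fun compl :: "literal \<Rightarrow> literal" where
  "compl (Pos i) = Neg i"
| "compl (Neg i) = Pos i"

fun sat_literal :: "(nat \<Rightarrow> bool) \<Rightarrow> literal \<Rightarrow> bool" where
  "sat_literal \<mu> (Pos i) \<longleftrightarrow> \<mu> i"
| "sat_literal \<mu> (Neg i) \<longleftrightarrow> \<not> \<mu> i"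

definition sat_clause :: "(nat \<Rightarrow> bool) \<Rightarrow> literal set \<Rightarrow> bool" where
  "sat_clause \<mu> C \<longleftrightarrow> (\<exists>l \<in> C. sat_literal \<mu> l)"

definition is_model :: "(nat \<Rightarrow> bool) \<Rightarrow> literal set set \<Rightarrow> bool" where
  "is_model \<mu> \<Sigma> \<longleftrightarrow> (\<forall>C \<in> \<Sigma>. sat_clause \<mu> C)"

definition literals_of :: "(nat \<rightharpoonup> bool) \<Rightarrow> literal set" where
  "literals_of e = {Pos i | i. e i = Some True} \<union> {Neg i | i. e i = Some False}"

text \<open>The clause $\neg e$, for $e$ read as the conjunction of its literals.\<close>

definition neg_clause :: "(nat \<rightharpoonup> bool) \<Rightarrow> literal set" where
  "neg_clause e = compl ` literals_of e"

definition cnf_of :: "('v, 'e) decision_diagram \<Rightarrow> literal set set" where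
  "cnf_of D = neg_clause ` off_set D"

end

theory Submission
  imports Defs
begin

text \<open>
  An interpretation falsifies the clause \<open>\<not>e\<close> iff it extends the partial assignment \<open>e\<close>. Since the
  variables increase strictly along a path, the assignment of a path records every edge of it, so
  \<open>\<mu>\<close> extends the assignment of a path to a 0-sink iff that path is the one which \<open>\<mu>\<close> follows.
  Following \<open>\<mu>\<close> is deterministic and ends in the sink labeled \<open>f \<mu>\<close>.
\<close>

lemma sat_neg_clause_iff: "sat_clause \<mu> (neg_clause e) \<longleftrightarrow> \<not> e \<subseteq>\<^sub>m (\<lambda>i. Some (\<mu> i))"
proof -
  have "sat_clause \<mu> (neg_clause e) \<longleftrightarrow>
      (\<exists>i. e i = Some True \<and> \<not> \<mu> i) \<or> (\<exists>i. e i = Some False \<and> \<mu> i)"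
    by (simp add: sat_clause_def neg_clause_def literals_of_def bex_Un) force
  also have "\<dots> \<longleftrightarrow> (\<exists>i b. e i = Some b \<and> b \<noteq> \<mu> i)"
    by (metis (full_types))
  also have "\<dots> \<longleftrightarrow> \<not> e \<subseteq>\<^sub>m (\<lambda>i. Some (\<mu> i))"
    by (auto simp: map_le_def dom_def)
  finally show ?thesis .
qed

lemma is_model_cnf_of_iff:
  "is_model \<mu> (cnf_of D) \<longleftrightarrow> (\<forall>e \<in> off_set D. \<not> e \<subseteq>\<^sub>m (\<lambda>i. Some (\<mu> i)))"
  by (simp add: is_model_def cnf_of_def sat_neg_clause_iff)

definition follows :: "('v, 'e) decision_diagram \<Rightarrow> (nat \<Rightarrow> bool) \<Rightarrow> 'e list \<Rightarrow> bool" where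
  "follows D x p \<longleftrightarrow> (\<forall>e \<in> set p. edge_value D e = x (var (label D (tail (dgraph D) e))))"

text \<open>Fixing the diagram in a locale allows \<open>awalk\<close>, \<open>apath\<close> and
  \<open>cycle\<close> to refer to \<open>dgraph D\<close> implicitly and gives access to the theory
  of finite digraphs.\<close>

locale ordered_diagram =
  fixes n :: nat and D :: "('v, 'e) decision_diagram"
  assumes obdd: "obdd n D"
begin

sublocale fin_digraph "dgraph D"
  using obdd by (simp add: obdd_def)

lemma acyclic: "\<not> cycle p"
  using obdd by (simp add: obdd_def)

lemma out_arcs_by_label:
  assumes "v \<in> verts (dgraph D)"
  shows "case label D v of
      Sink b \<Rightarrow> out_arcs (dgraph D) v = {}
    | Var i \<Rightarrow> i \<in> {1..n} \<and> bij_betw (edge_value D) (out_arcs (dgraph D) v) UNIV"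
  using obdd[unfolded obdd_def] assms by (elim conjE) (rule bspec)

lemma arc_labels_less:
  assumes "e \<in> arcs (dgraph D)"
    and "label D (tail (dgraph D) e) = Var i" "label D (head (dgraph D) e) = Var j"
  shows "i < j"
  using obdd[unfolded obdd_def, THEN conjunct2, THEN conjunct2, THEN conjunct2, THEN conjunct2,
      THEN conjunct2] assms by blast

lemma out_arcs_sink:
  "v \<in> verts (dgraph D) \<Longrightarrow> label D v = Sink b \<Longrightarrow> out_arcs (dgraph D) v = {}"
  using out_arcs_by_label by force

lemma out_arcs_eqI:
  assumes "e \<in> out_arcs (dgraph D) v" "e' \<in> out_arcs (dgraph D) v" "label D v = Var i"
    and "edge_value D e = edge_value D e'"
  shows "e = e'"
proof -
  have "v \<in> verts (dgraph D)"
    using assms(1) by auto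
  then have "inj_on (edge_value D) (out_arcs (dgraph D) v)"
    using out_arcs_by_label[of v] assms(3) by (simp add: bij_betw_def)
  then show ?thesis
    using assms by (auto dest: inj_onD)
qed

text \<open>Sinks have no outgoing edges. Hence \<open>var\<close> is only ever applied to variable
  labels along a walk; its value on a sink label is unspecified.\<close>

lemma label_tail:
  assumes "e \<in> arcs (dgraph D)"
  obtains i where "label D (tail (dgraph D) e) = Var i"
  using assms out_arcs_sink[of "tail (dgraph D) e"]
  by (cases "label D (tail (dgraph D) e)") auto

lemma var_less:
  assumes "e \<in> arcs (dgraph D)" "e' \<in> arcs (dgraph D)"
    and "tail (dgraph D) e' = head (dgraph D) e"
  shows "var (label D (tail (dgraph D) e)) < var (label D (tail (dgraph D) e'))"
proof -
  obtain i j where "label D (tail (dgraph D) e) = Var i" "label D (tail (dgraph D) e') = Var j"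
    using assms label_tail by metis
  then show ?thesis
    using assms arc_labels_less by simp
qed

text \<open>At each node the label decides which rule of \<open>leads_to\<close> applies, and at a
  variable node injectivity of \<open>edge_value\<close> on the outgoing edges forces both
  derivations to take the same edge.\<close>

lemma leads_to_unique: "leads_to D x v b \<Longrightarrow> leads_to D x v c \<Longrightarrow> b = c"
proof (induction rule: leads_to.induct)
  case (sink v b)
  from sink.prems show ?case
    using sink.hyps by cases auto
next
  case (step e v i b)
  from step.prems show ?case
  proof cases
    case sink
    then show ?thesis using step by simp
  next
    case (step e' j)
    then show ?thesis
      using step.hyps step.IH out_arcs_eqI[of e v e' i] by simp
  qed
qed

text \<open>This turns the inductive evaluation into a statement about walks, the language in which
  \<open>off_set\<close> is phrased.\<close>

lemma leads_to_iff_awalk: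
  "leads_to D x v b \<longleftrightarrow> (\<exists>p t. awalk v p t \<and> follows D x p \<and> label D t = Sink b)"
proof
  assume "leads_to D x v b"
  then show "\<exists>p t. awalk v p t \<and> follows D x p \<and> label D t = Sink b"
  proof induction
    case (sink v b)
    then have "awalk v [] v \<and> follows D x [] \<and> label D v = Sink b"
      by (simp add: awalk_Nil_iff follows_def)
    then show ?case by blast
  next
    case (step e v i b)
    then obtain p t where "awalk (head (dgraph D) e) p t" "follows D x p" "label D t = Sink b"
      by blast
    then have "awalk v (e # p) t \<and> follows D x (e # p) \<and> label D t = Sink b"
      using step.hyps by (auto simp: awalk_Cons_iff follows_def)
    then show ?case by blast
  qed
next
  have "leads_to D x v b" if "awalk v p t" "follows D x p" "label D t = Sink b" for p t
    using that
  proof (induction p arbitrary: v)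
    case Nil
    then show ?case
      by (auto simp: awalk_Nil_iff intro: leads_to.sink)
  next
    case (Cons e p)
    obtain i where "label D (tail (dgraph D) e) = Var i"
      using Cons.prems(1) label_tail by (auto simp: awalk_Cons_iff)
    with Cons show ?case
      by (intro leads_to.step[of e D v i]) (auto simp: awalk_Cons_iff follows_def)
  qed
  then show "\<exists>p t. awalk v p t \<and> follows D x p \<and> label D t = Sink b \<Longrightarrow> leads_to D x v b"
    by blast
qed

text \<open>A repeated vertex would split off a closed walk, which contains a cycle. So the simple
  paths in \<open>off_set\<close> are exactly the walks that evaluation produces.\<close>

lemma apath_iff_awalk: "apath u p v \<longleftrightarrow> awalk u p v"
proof
  assume p: "awalk u p v"
  have "distinct (awalk_verts u p)"
  proof (rule ccontr)
    assume "\<not> distinct (awalk_verts u p)"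
    from awalk_not_distinct_decomp[OF p this] obtain r where "closed_w r"
      by (auto simp: closed_w_def)
    then show False
      using closed_w_imp_cycle acyclic by blast
  qed
  with p show "apath u p v"
    by (simp add: apath_def)
qed (rule awalkI_apath)

lemma vars_increasing:
  "awalk v p t \<Longrightarrow> sorted_wrt (<) (map (\<lambda>e. var (label D (tail (dgraph D) e))) p)"
proof (induction p arbitrary: v)
  case Nil
  then show ?case by simp
next
  case (Cons e p)
  then have IH: "sorted_wrt (<) (map (\<lambda>e. var (label D (tail (dgraph D) e))) p)"
    by (auto simp: awalk_Cons_iff)
  show ?case
  proof (cases p)
    case (Cons e' q)
    then have "var (label D (tail (dgraph D) e)) < var (label D (tail (dgraph D) e'))"
      using Cons.prems by (intro var_less) (auto simp: awalk_Cons_iff)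
    \<comment> \<open>By transitivity of \<open><\<close>, comparing neighbours suffices
      (\<open>sorted_wrt2\<close>); the defining equations, which compare \<open>e\<close> with all
      later edges, are switched off.\<close>
    then show ?thesis
      using IH Cons by (simp add: sorted_wrt2 del: sorted_wrt.simps)
  qed simp
qed

text \<open>Strictly increasing variables are distinct keys, so \<open>map_of\<close> keeps the
  value of every edge and extending the assignment means agreeing with each edge.\<close>

lemma path_assignment_le_iff:
  assumes "awalk v p t"
  shows "path_assignment D p \<subseteq>\<^sub>m (\<lambda>i. Some (x i)) \<longleftrightarrow> follows D x p"
proof -
  have "distinct (map (\<lambda>e. var (label D (tail (dgraph D) e))) p)"
    using vars_increasing[OF assms] strict_sorted_iff by blast
  then have "path_assignment D p i = Some b \<longleftrightarrow>
      (\<exists>e \<in> set p. var (label D (tail (dgraph D) e)) = i \<and> edge_value D e = b)" for i b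
    unfolding path_assignment_def by (subst map_of_eq_Some_iff) (auto simp: comp_def)
  moreover have "path_assignment D p \<subseteq>\<^sub>m (\<lambda>i. Some (x i)) \<longleftrightarrow>
      (\<forall>i b. path_assignment D p i = Some b \<longrightarrow> b = x i)"
    by (auto simp: map_le_def dom_def)
  ultimately have "path_assignment D p \<subseteq>\<^sub>m (\<lambda>i. Some (x i)) \<longleftrightarrow>
      (\<forall>i b. (\<exists>e \<in> set p. var (label D (tail (dgraph D) e)) = i \<and> edge_value D e = b) \<longrightarrow> b = x i)"
    by simp
  then show ?thesis
    unfolding follows_def by metis
qed

lemma is_model_iff: "is_model x (cnf_of D) \<longleftrightarrow> \<not> leads_to D x (root D) False"
proof -
  have "is_model x (cnf_of D) \<longleftrightarrow>
      \<not> (\<exists>p t. awalk (root D) p t \<and> label D t = Sink False \<and>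
        path_assignment D p \<subseteq>\<^sub>m (\<lambda>i. Some (x i)))"
    by (auto simp: is_model_cnf_of_iff off_set_def apath_iff_awalk)
  also have "\<dots> \<longleftrightarrow> \<not> leads_to D x (root D) False"
    unfolding leads_to_iff_awalk using path_assignment_le_iff by blast
  finally show ?thesis .
qed

end

theorem proposition1:
  fixes n :: nat
    and f :: "(nat \<Rightarrow> bool) \<Rightarrow> bool"
    and D :: "('v, 'e) decision_diagram"
    and \<mu> :: "nat \<Rightarrow> bool"
  assumes "obdd n D"
    and "represents n D f"
    and "\<mu> \<in> interps n"
  shows "is_model \<mu> (cnf_of D) \<longleftrightarrow> f \<mu> = True"
proof -
  interpret ordered_diagram n D
    using assms(1) by (rule ordered_diagram.intro)
  have "leads_to D \<mu> (root D) (f \<mu>)"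
    using assms(2,3) by (simp add: represents_def)
  \<comment> \<open>There are only two classes: if \<open>f \<mu>\<close> is not
    \<open>False\<close>, reaching a 0-sink as well would contradict uniqueness.\<close>
  then have "leads_to D \<mu> (root D) False \<longleftrightarrow> f \<mu> = False"
    using leads_to_unique by (metis (full_types))
  then show ?thesis
    by (simp add: is_model_iff)
qed

end
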